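(* (Church–Rosser, up to $\alpha$-conversion.) (i) For all terms $M,N,P\in\Lambda$, if $M\twoheadrightarrow_\beta N$ and $M\twoheadrightarrow_\beta P$, then there exist terms $Q_1,Q_2$ such that $N\twoheadrightarrow_\beta Q_1$, $P\twoheadrightarrow_\beta Q_2$ and $Q_1\sim_\alpha Q_2$. (ii) For all terms $M,N\in\Lambda$, if $M\simeq_\beta N$, then there exist terms $P_1,P_2$ such that $M\twoheadrightarrow_\beta P_1$, $N\twoheadrightarrow_\beta P_2$ and $P_1\sim_\alpha P_2$.
   Context: Syntax. Fix a type $\mathcal C$ of constants and a countably infinite type $\mathcal V$ of variables with decidable equality and a fixed enumeration. Raw terms $\Lambda$ (NOT identified up to $\alpha$) are given by $M,N,A,B::= c \mid x \mid \lambda[x:A]M \mid \Pi[x:A]B \mid M\cdot N$ with $c\in\mathcal C$, $x\in\mathcal V$. $\mathrm{fv}(M)$ is the (finite list of) free variables, where $\lambda[x:A]M$ and $\Pi[x:A]M$ bind $x$ in $M$ but not in $A$; $\mathrm{fv}(M)-x$ is $\mathrm{fv}(M)$ with $x$ removed. $\equiv$ is syntactic identity. Substitution (Stoughton). A substitution is a function $\sigma:\mathcal V\to\Lambda$; $\iota$ is the identity substitution; $(\sigma,x:=N)$ maps $x$ to $N$ and any other $y$ to $\sigma y$. For a finite list $xs$ of variables, $X(\sigma,xs)$ is the first variable (in the enumeration) not occurring free in $\sigma y$ for any $y\in xs$. Define $c\bullet\sigma=c$, $x\bullet\sigma=\sigma x$, $(M\cdot N)\bullet\sigma=(M\bullet\sigma)\cdot(N\bullet\sigma)$,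 and for $Q\in\{\lambda,\Pi\}$, $(Q[x:A]M)\bullet\sigma=Q[y:A\bullet\sigma](M\bullet(\sigma,x:=y))$ where $y=X(\sigma,\mathrm{fv}(M)-x)$. Write $M[x:=N]$ for $M\bullet(\iota,x:=N)$. $\alpha$-conversion $\sim_\alpha$ is inductively defined by: $c\sim_\alpha c$; $x\sim_\alpha x$; if $M\sim_\alpha M'$ and $N\sim_\alpha N'$ then $M\cdot N\sim_\alpha M'\cdot N'$; for $Q\in\{\lambda,\Pi\}$, if $A\sim_\alpha A'$ and $M[x:=y]\equiv M'[x':=y]$ for some $y\notin\mathrm{fv}(M)-x$, $y\notin\mathrm{fv}(M')-x'$, then $Q[x:A]M\sim_\alpha Q[x':A']M'$. $\beta$-reduction. $\to_\beta$ is the contextual closure (under both positions of application, and both the domain and the body of $\lambda$ and $\Pi$) of the contraction $(\lambda[x:A]M)\cdot N\triangleright_\beta M[x:=N]$. $\twoheadrightarrow_\beta$ is the reflexive-transitive closure of $\to_\beta$ (no $\alpha$-steps). $\simeq_\beta$ is the least equivalence relation containing $\sim_\alpha$ and $\to_\beta$. *)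

theory Defs
  imports Main
begin

datatype abstractor = Lambda | Pi

text \<open>Raw terms, not identified up to renaming of bound variables. The term
  \<open>Q[x:A]M\<close> with \<open>Q\<close> one of \<open>\<lambda>\<close>, \<open>\<Pi>\<close> is \<open>Bind Q x A M\<close>; it binds \<open>x\<close> in \<open>M\<close> only.\<close>

datatype ('c, 'v) trm =
    Const 'c
  | Var 'v
  | Bind abstractor 'v "('c, 'v) trm" "('c, 'v) trm"
  | App "('c, 'v) trm" "('c, 'v) trm"

primrec fv :: "('c, 'v) trm \<Rightarrow> 'v list" where
  "fv (Const c) = []"
| "fv (Var x) = [x]"
| "fv (Bind Q x A M) = fv A @ removeAll x (fv M)"
| "fv (App M N) = fv M @ fv N"

type_synonym ('c, 'v) substitution = "'v \<Rightarrow> ('c, 'v) trm"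

text \<open>The parameter \<open>e\<close> is the enumeration of the variables. The identity substitution is
  \<open>Var\<close>, and the updated substitution \<open>(\<sigma>, x := N)\<close> is the function update \<open>\<sigma>(x := N)\<close>.\<close>

definition choice :: "(nat \<Rightarrow> 'v) \<Rightarrow> ('c, 'v) substitution \<Rightarrow> 'v list \<Rightarrow> 'v" where
  "choice e \<sigma> xs = e (LEAST n. \<forall>y\<in>set xs. e n \<notin> set (fv (\<sigma> y)))"

lemma choice_fresh:
  assumes "bij e" and "y \<in> set xs"
  shows "choice e \<sigma> xs \<notin> set (fv (\<sigma> y))"
proof -
  let ?P = "\<lambda>n. \<forall>y\<in>set xs. e n \<notin> set (fv (\<sigma> y))"
  have "finite (\<Union>y\<in>set xs. set (fv (\<sigma> y)))" by simp
  moreover have "infinite (range e)"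
    using assms(1) by (simp add: bij_is_inj finite_image_iff)
  ultimately obtain v where "v \<in> range e" "v \<notin> (\<Union>y\<in>set xs. set (fv (\<sigma> y)))"
    by (meson finite_subset subsetI)
  then obtain n where "?P n" by auto
  then have "?P (LEAST n. ?P n)" by (rule LeastI)
  then show ?thesis using assms(2) by (simp add: choice_def)
qed

primrec subst :: "(nat \<Rightarrow> 'v) \<Rightarrow> ('c, 'v) trm \<Rightarrow> ('c, 'v) substitution \<Rightarrow> ('c, 'v) trm" where
  "subst e (Const c) \<sigma> = Const c"
| "subst e (Var x) \<sigma> = \<sigma> x"
| "subst e (Bind Q x A M) \<sigma> =
     (let y = choice e \<sigma> (removeAll x (fv M))
      in Bind Q y (subst e A \<sigma>) (subst e M (\<sigma>(x := Var y))))"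
| "subst e (App M N) \<sigma> = App (subst e M \<sigma>) (subst e N \<sigma>)"

definition subst1 :: "(nat \<Rightarrow> 'v) \<Rightarrow> ('c, 'v) trm \<Rightarrow> 'v \<Rightarrow> ('c, 'v) trm \<Rightarrow> ('c, 'v) trm" where
  "subst1 e M x N = subst e M (Var(x := N))"

inductive alpha :: "(nat \<Rightarrow> 'v) \<Rightarrow> ('c, 'v) trm \<Rightarrow> ('c, 'v) trm \<Rightarrow> bool"
  for e :: "nat \<Rightarrow> 'v" where
  Const: "alpha e (Const c) (Const c)"
| Var: "alpha e (Var x) (Var x)"
| App: "alpha e M M' \<Longrightarrow> alpha e N N' \<Longrightarrow> alpha e (App M N) (App M' N')"
| Bind: "alpha e A A' \<Longrightarrow>
     y \<notin> set (removeAll x (fv M)) \<Longrightarrow> y \<notin> set (removeAll x' (fv M')) \<Longrightarrow>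
     subst1 e M x (Var y) = subst1 e M' x' (Var y) \<Longrightarrow>
     alpha e (Bind Q x A M) (Bind Q x' A' M')"

inductive beta :: "(nat \<Rightarrow> 'v) \<Rightarrow> ('c, 'v) trm \<Rightarrow> ('c, 'v) trm \<Rightarrow> bool"
  for e :: "nat \<Rightarrow> 'v" where
  contract: "beta e (App (Bind Lambda x A M) N) (subst1 e M x N)"
| App_left: "beta e M M' \<Longrightarrow> beta e (App M N) (App M' N)"
| App_right: "beta e N N' \<Longrightarrow> beta e (App M N) (App M N')"
| Bind_domain: "beta e A A' \<Longrightarrow> beta e (Bind Q x A M) (Bind Q x A' M)"
| Bind_body: "beta e M M' \<Longrightarrow> beta e (Bind Q x A M) (Bind Q x A M')"

definition beta_steps :: "(nat \<Rightarrow> 'v) \<Rightarrow> ('c, 'v) trm \<Rightarrow> ('c, 'v) trm \<Rightarrow> bool" where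
  "beta_steps e = (beta e)\<^sup>*\<^sup>*"

definition beta_conv :: "(nat \<Rightarrow> 'v) \<Rightarrow> ('c, 'v) trm \<Rightarrow> ('c, 'v) trm \<Rightarrow> bool" where
  "beta_conv e = equivclp (\<lambda>M N. alpha e M N \<or> beta e M N)"

end

(* Raw terms are interpreted as de Bruijn terms under an environment that sends variables to
   de Bruijn terms. Substitution on raw terms becomes composition of environments, so that raw
   beta-steps correspond exactly to de Bruijn beta-steps, and for an injective environment of
   variables two raw terms have the same interpretation iff they are alpha-convertible. Confluence
   of de Bruijn terms (by complete developments) thus transfers to raw terms up to alpha. *)

theory Submission
  imports Defs "HOL-Library.Confluence"
begin

section \<open>De Bruijn terms\<close>

datatype 'c dterm =
    DConst 'c
  | DVar nat
  | DBind abstractor "'c dterm" "'c dterm"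
  | DApp "'c dterm" "'c dterm"

primrec ren :: "'c dterm \<Rightarrow> (nat \<Rightarrow> nat) \<Rightarrow> 'c dterm" where
  "ren (DConst c) f = DConst c"
| "ren (DVar n) f = DVar (f n)"
| "ren (DBind Q A M) f = DBind Q (ren A f) (ren M (case_nat 0 (Suc \<circ> f)))"
| "ren (DApp M N) f = DApp (ren M f) (ren N f)"

abbreviation lift :: "'c dterm \<Rightarrow> 'c dterm" where
  "lift t \<equiv> ren t Suc"

definition up :: "(nat \<Rightarrow> 'c dterm) \<Rightarrow> nat \<Rightarrow> 'c dterm" where
  "up \<tau> = case_nat (DVar 0) (lift \<circ> \<tau>)"

primrec dsub :: "'c dterm \<Rightarrow> (nat \<Rightarrow> 'c dterm) \<Rightarrow> 'c dterm" where
  "dsub (DConst c) \<tau> = DConst c"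
| "dsub (DVar n) \<tau> = \<tau> n"
| "dsub (DBind Q A M) \<tau> = DBind Q (dsub A \<tau>) (dsub M (up \<tau>))"
| "dsub (DApp M N) \<tau> = DApp (dsub M \<tau>) (dsub N \<tau>)"

text \<open>\<open>Suc n\<close> goes to \<open>DVar n\<close> because the binder that held index 0
  disappears on contraction, so the remaining indices drop by one.\<close>

abbreviation inst :: "'c dterm \<Rightarrow> 'c dterm \<Rightarrow> 'c dterm" where
  "inst M N \<equiv> dsub M (case_nat N DVar)"

lemma up_simps [simp]: "up \<tau> 0 = DVar 0" "up \<tau> (Suc n) = lift (\<tau> n)"
  by (simp_all add: up_def)

text \<open>The fusion laws are ordered by what their binder cases need: \<open>ren_dsub\<close>
  uses \<open>ren_ren\<close> to move a renaming past \<open>lift\<close>, and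
  \<open>dsub_dsub\<close> uses both mixed laws through \<open>dsub_up_lift\<close>.\<close>

lemma ren_ren: "ren (ren t f) g = ren t (\<lambda>n. g (f n))"
proof (induction t arbitrary: f g)
  case (DBind Q A M)
  have "(\<lambda>n. case_nat 0 (Suc \<circ> g) (case_nat 0 (Suc \<circ> f) n)) = case_nat 0 (Suc \<circ> (\<lambda>n. g (f n)))"
    by (auto split: nat.split)
  with DBind show ?case by simp
qed simp_all

lemma dsub_ren: "dsub (ren t f) \<tau> = dsub t (\<lambda>n. \<tau> (f n))"
proof (induction t arbitrary: f \<tau>)
  case (DBind Q A M)
  have "(\<lambda>n. up \<tau> (case_nat 0 (Suc \<circ> f) n)) = up (\<lambda>n. \<tau> (f n))"
    by (auto simp: up_def split: nat.split)
  with DBind show ?case by simp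
qed simp_all

lemma ren_dsub: "ren (dsub t \<tau>) f = dsub t (\<lambda>n. ren (\<tau> n) f)"
proof (induction t arbitrary: f \<tau>)
  case (DBind Q A M)
  have "(\<lambda>n. ren (up \<tau> n) (case_nat 0 (Suc \<circ> f))) = up (\<lambda>n. ren (\<tau> n) f)"
    by (auto simp: up_def ren_ren comp_def split: nat.split)
  with DBind show ?case by simp
qed simp_all

lemma dsub_up_lift: "dsub (lift t) (up \<tau>) = lift (dsub t \<tau>)"
  by (simp add: dsub_ren ren_dsub comp_def)

lemma dsub_dsub: "dsub (dsub t \<tau>) \<upsilon> = dsub t (\<lambda>n. dsub (\<tau> n) \<upsilon>)"
proof (induction t arbitrary: \<tau> \<upsilon>)
  case (DBind Q A M)
  have "dsub (up \<tau> n) (up \<upsilon>) = up (\<lambda>n. dsub (\<tau> n) \<upsilon>) n" for n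
    by (cases n) (simp_all add: dsub_up_lift)
  with DBind show ?case by simp
qed simp_all

lemma up_DVar: "up DVar = DVar"
  by (auto simp: up_def split: nat.split)

lemma dsub_DVar: "dsub t DVar = t"
  by (induction t) (simp_all add: up_DVar)

text \<open>By fusion both sides apply one composed substitution to \<open>M\<close>. At index 0
  each gives \<open>dsub N \<tau>\<close>; at \<open>Suc n\<close> the instantiation on the right
  cancels the \<open>lift\<close> introduced by \<open>up\<close>.\<close>

lemma dsub_inst: "dsub (inst M N) \<tau> = inst (dsub M (up \<tau>)) (dsub N \<tau>)"
proof -
  have "dsub (case_nat N DVar n) \<tau> = inst (up \<tau> n) (dsub N \<tau>)" for n
    by (cases n) (simp_all add: dsub_ren dsub_DVar)
  then show ?thesis by (simp add: dsub_dsub)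
qed

lemma ren_eq_dsub: "ren t f = dsub t (\<lambda>n. DVar (f n))"
  using dsub_DVar[of "ren t f"] by (simp add: dsub_ren)

section \<open>Confluence of de Bruijn terms\<close>

inductive dbeta :: "'c dterm \<Rightarrow> 'c dterm \<Rightarrow> bool" where
  contract: "dbeta (DApp (DBind Lambda A M) N) (inst M N)"
| App_left: "dbeta M M' \<Longrightarrow> dbeta (DApp M N) (DApp M' N)"
| App_right: "dbeta N N' \<Longrightarrow> dbeta (DApp M N) (DApp M N')"
| Bind_domain: "dbeta A A' \<Longrightarrow> dbeta (DBind Q A M) (DBind Q A' M)"
| Bind_body: "dbeta M M' \<Longrightarrow> dbeta (DBind Q A M) (DBind Q A M')"

inductive_cases dbeta_DConstE: "dbeta (DConst c) t"
  and dbeta_DVarE: "dbeta (DVar n) t"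
  and dbeta_DBindE: "dbeta (DBind Q A M) t"
  and dbeta_DAppE: "dbeta (DApp M N) t"

text \<open>Parallel reduction in the style of Tait and Martin-Loef. It lies between
  \<open>dbeta\<close> and its reflexive-transitive closure, so confluence of \<open>par\<close>
  carries over to \<open>dbeta\<close>.\<close>

inductive par :: "'c dterm \<Rightarrow> 'c dterm \<Rightarrow> bool" where
  DConst: "par (DConst c) (DConst c)"
| DVar: "par (DVar n) (DVar n)"
| DBind: "par A A' \<Longrightarrow> par M M' \<Longrightarrow> par (DBind Q A M) (DBind Q A' M')"
| DApp: "par M M' \<Longrightarrow> par N N' \<Longrightarrow> par (DApp M N) (DApp M' N')"
| contract: "par M M' \<Longrightarrow> par N N' \<Longrightarrow> par (DApp (DBind Lambda A M) N) (inst M' N')"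

inductive_cases par_DBindE: "par (DBind Q A M) t"

lemma par_refl: "par t t"
  by (induction t) (auto intro: par.intros)

lemma dbeta_imp_par: "dbeta t u \<Longrightarrow> par t u"
  by (induction rule: dbeta.induct) (auto intro: par.intros par_refl)

lemma dbeta_rtranclp_DBind:
  assumes "dbeta\<^sup>*\<^sup>* A A'" "dbeta\<^sup>*\<^sup>* M M'"
  shows "dbeta\<^sup>*\<^sup>* (DBind Q A M) (DBind Q A' M')"
proof -
  from assms(1) have "dbeta\<^sup>*\<^sup>* (DBind Q A M) (DBind Q A' M)"
    by induction (auto intro: rtranclp.rtrancl_into_rtrancl dbeta.Bind_domain)
  moreover from assms(2) have "dbeta\<^sup>*\<^sup>* (DBind Q A' M) (DBind Q A' M')"
    by induction (auto intro: rtranclp.rtrancl_into_rtrancl dbeta.Bind_body)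
  ultimately show ?thesis by (rule rtranclp_trans)
qed

lemma dbeta_rtranclp_DApp:
  assumes "dbeta\<^sup>*\<^sup>* M M'" "dbeta\<^sup>*\<^sup>* N N'"
  shows "dbeta\<^sup>*\<^sup>* (DApp M N) (DApp M' N')"
proof -
  from assms(1) have "dbeta\<^sup>*\<^sup>* (DApp M N) (DApp M' N)"
    by induction (auto intro: rtranclp.rtrancl_into_rtrancl dbeta.App_left)
  moreover from assms(2) have "dbeta\<^sup>*\<^sup>* (DApp M' N) (DApp M' N')"
    by induction (auto intro: rtranclp.rtrancl_into_rtrancl dbeta.App_right)
  ultimately show ?thesis by (rule rtranclp_trans)
qed

lemma par_imp_dbeta_rtranclp: "par t u \<Longrightarrow> dbeta\<^sup>*\<^sup>* t u"
proof (induction rule: par.induct)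
  case (contract M M' N N' A)
  then have "dbeta\<^sup>*\<^sup>* (DApp (DBind Lambda A M) N) (DApp (DBind Lambda A M') N')"
    by (intro dbeta_rtranclp_DApp dbeta_rtranclp_DBind) auto
  then show ?case
    by (rule rtranclp.rtrancl_into_rtrancl) (rule dbeta.contract)
qed (auto intro: dbeta_rtranclp_DApp dbeta_rtranclp_DBind)

text \<open>Proved ahead of \<open>par_dsub\<close> because going under a binder lifts the
  substituted terms, and \<open>lift\<close> is itself a fixed substitution by
  \<open>ren_eq_dsub\<close>.\<close>

lemma par_dsub_same: "par t u \<Longrightarrow> par (dsub t \<tau>) (dsub u \<tau>)"
proof (induction arbitrary: \<tau> rule: par.induct)
  case (contract M M' N N' A)
  then show ?case by (simp add: dsub_inst par.contract)
qed (auto intro: par.intros par_refl)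

lemma par_up:
  assumes "\<And>n. par (\<tau> n) (\<tau>' n)"
  shows "par (up \<tau> n) (up \<tau>' n)"
  using assms by (cases n) (auto simp: ren_eq_dsub intro: par_dsub_same par_refl)

lemma par_dsub: "par t u \<Longrightarrow> (\<And>n. par (\<tau> n) (\<tau>' n)) \<Longrightarrow> par (dsub t \<tau>) (dsub u \<tau>')"
proof (induction arbitrary: \<tau> \<tau>' rule: par.induct)
  case (DBind A A' M M' Q)
  have "par (dsub A \<tau>) (dsub A' \<tau>')" by (rule DBind.IH(1)) (rule DBind.prems)
  moreover have "par (dsub M (up \<tau>)) (dsub M' (up \<tau>'))"
    by (rule DBind.IH(2)) (rule par_up, rule DBind.prems)
  ultimately show ?case by (simp add: par.DBind)
next
  case (contract M M' N N' A)
  have "par (dsub N \<tau>) (dsub N' \<tau>')" by (rule contract.IH(2)) (rule contract.prems)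
  moreover have "par (dsub M (up \<tau>)) (dsub M' (up \<tau>'))"
    by (rule contract.IH(1)) (rule par_up, rule contract.prems)
  ultimately show ?case by (simp add: dsub_inst par.contract)
qed (simp_all add: par.intros)

lemma par_inst:
  assumes "par M M'" "par N N'"
  shows "par (inst M N) (inst M' N')"
proof (rule par_dsub[OF assms(1)])
  show "par (case_nat N DVar n) (case_nat N' DVar n)" for n
    by (cases n) (simp_all add: assms(2) par_refl)
qed

text \<open>The complete development: all redexes present in the term are contracted at once. The
  last equation covers every application whose head is not a \<open>Lambda\<close> binder,
  \<open>Pi\<close> binders included.\<close>

fun dev :: "'c dterm \<Rightarrow> 'c dterm" where
  "dev (DConst c) = DConst c"
| "dev (DVar n) = DVar n"
| "dev (DBind Q A M) = DBind Q (dev A) (dev M)"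
| "dev (DApp (DBind Lambda A M) N) = inst (dev M) (dev N)"
| "dev (DApp M N) = DApp (dev M) (dev N)"

text \<open>Takahashi's triangle property: whatever a parallel step left uncontracted can be
  contracted in one more step, and the target depends on \<open>t\<close> alone.\<close>

lemma par_dev: "par t u \<Longrightarrow> par u (dev t)"
proof (induction rule: par.induct)
  case (DApp M M' N N')
  show ?case
  proof (cases "\<exists>A K. M = DBind Lambda A K")
    case True
    then obtain A K where M: "M = DBind Lambda A K" by blast
    \<comment> \<open>A step out of an abstraction ends in an abstraction, so the redex that the
      congruence step kept is still there to be contracted.\<close>
    with DApp.hyps obtain A' K' where "M' = DBind Lambda A' K'"
      by (auto elim: par_DBindE)
    with M DApp.IH show ?thesis by (auto elim: par_DBindE intro: par.contract)
  next
    case False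
    then have "dev (DApp M N) = DApp (dev M) (dev N)"
      by (cases "DApp M N" rule: dev.cases) auto
    with DApp.IH show ?thesis by (simp add: par.DApp)
  qed
qed (auto intro: par.intros par_inst)

lemma confluentp_dbeta: "confluentp (dbeta :: 'c dterm \<Rightarrow> _)"
proof -
  have "strong_confluentp (par :: 'c dterm \<Rightarrow> _)"
    \<comment> \<open>Two parallel steps out of the same \<open>t\<close> meet in
      \<open>dev t\<close>, with one step on each side.\<close>
    by (rule strong_confluentpI) (meson par_dev r_into_rtranclp sup2CI)
  then have "confluentp (par :: 'c dterm \<Rightarrow> _)"
    by (rule strong_confluentp_imp_confluentp)
  moreover have "(par :: 'c dterm \<Rightarrow> _)\<^sup>*\<^sup>* = dbeta\<^sup>*\<^sup>*"
    by (rule rtranclp_subset) (auto intro: dbeta_imp_par par_imp_dbeta_rtranclp)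
  ultimately show ?thesis by (simp add: confluentp_def rtranclp_conversep)
qed

section \<open>Interpretation of raw terms\<close>

definition bind_env :: "'v \<Rightarrow> ('v \<Rightarrow> 'c dterm) \<Rightarrow> 'v \<Rightarrow> 'c dterm" where
  "bind_env x \<rho> = (lift \<circ> \<rho>)(x := DVar 0)"

text \<open>Environments take de Bruijn terms, not just indices, as values; this makes the effect of
  a raw substitution expressible as a change of environment.\<close>

primrec nameless :: "('c, 'v) trm \<Rightarrow> ('v \<Rightarrow> 'c dterm) \<Rightarrow> 'c dterm" where
  "nameless (Const c) \<rho> = DConst c"
| "nameless (Var x) \<rho> = \<rho> x"
| "nameless (Bind Q x A M) \<rho> = DBind Q (nameless A \<rho>) (nameless M (bind_env x \<rho>))"
| "nameless (App M N) \<rho> = DApp (nameless M \<rho>) (nameless N \<rho>)"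

lemma nameless_cong: "(\<And>x. x \<in> set (fv M) \<Longrightarrow> \<rho> x = \<rho>' x) \<Longrightarrow> nameless M \<rho> = nameless M \<rho>'"
proof (induction M arbitrary: \<rho> \<rho>')
  case (Bind Q x A M)
  have "nameless A \<rho> = nameless A \<rho>'" using Bind.prems by (intro Bind.IH) auto
  moreover have "nameless M (bind_env x \<rho>) = nameless M (bind_env x \<rho>')"
    using Bind.prems by (intro Bind.IH) (auto simp: bind_env_def)
  ultimately show ?case by simp
next
  case (App K L)
  have "nameless K \<rho> = nameless K \<rho>'" using App.prems by (intro App.IH) auto
  moreover have "nameless L \<rho> = nameless L \<rho>'" using App.prems by (intro App.IH) auto
  ultimately show ?case by simp
qed simp_all

lemma dsub_nameless: "dsub (nameless M \<rho>) \<tau> = nameless M (\<lambda>x. dsub (\<rho> x) \<tau>)"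
proof (induction M arbitrary: \<rho> \<tau>)
  case (Bind Q x A M)
  have "dsub (bind_env x \<rho> z) (up \<tau>) = bind_env x (\<lambda>z. dsub (\<rho> z) \<tau>) z" for z
    by (simp add: bind_env_def dsub_up_lift)
  with Bind show ?case by simp
qed simp_all

lemma lift_nameless: "nameless M (lift \<circ> \<rho>) = lift (nameless M \<rho>)"
  by (simp add: ren_eq_dsub dsub_nameless comp_def)

lemma nameless_bind_env_fresh:
  assumes "y \<notin> set (fv M)"
  shows "nameless M (bind_env y \<rho>) = lift (nameless M \<rho>)"
  unfolding lift_nameless[symmetric] using assms
  by (intro nameless_cong) (auto simp: bind_env_def)

lemma nameless_subst:
  assumes "bij e"
  shows "nameless (subst e M \<sigma>) \<rho> = nameless M (\<lambda>x. nameless (\<sigma> x) \<rho>)"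
proof (induction M arbitrary: \<sigma> \<rho>)
  case (Bind Q x A M)
  define y where "y = choice e \<sigma> (removeAll x (fv M))"
  have fresh: "y \<notin> set (fv (\<sigma> z))" if "z \<in> set (fv M)" "z \<noteq> x" for z
    unfolding y_def using that by (intro choice_fresh assms) auto
  \<comment> \<open>The variable \<open>x\<close> reaches index 0 by way of \<open>y\<close>. For
    any other free \<open>z\<close>, freshness of \<open>y\<close> in \<open>\<sigma> z\<close>
    means that crossing the new binder merely lifts its interpretation: nothing is captured.\<close>
  have "nameless M (\<lambda>z. nameless ((\<sigma>(x := Var y)) z) (bind_env y \<rho>))
      = nameless M (bind_env x (\<lambda>z. nameless (\<sigma> z) \<rho>))"
    using fresh by (intro nameless_cong)
      (auto simp: nameless_bind_env_fresh, auto simp: bind_env_def)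
  then show ?case by (simp add: Let_def y_def[symmetric] Bind.IH del: fun_upd_apply)
qed simp_all

text \<open>Both sides interpret \<open>M\<close> in one environment: \<open>x\<close> receives the
  interpretation of \<open>N\<close>, and elsewhere \<open>inst\<close> undoes the lifting by
  \<open>bind_env\<close>.\<close>

lemma nameless_subst1:
  assumes "bij e"
  shows "nameless (subst1 e M x N) \<rho> = inst (nameless M (bind_env x \<rho>)) (nameless N \<rho>)"
  unfolding subst1_def nameless_subst[OF assms] dsub_nameless
  by (intro nameless_cong) (simp add: bind_env_def dsub_ren dsub_DVar)

section \<open>Alpha-conversion is equality of interpretations\<close>

lemma alpha_imp_nameless_eq:
  assumes "bij e"
  shows "alpha e M N \<Longrightarrow> nameless M \<rho> = nameless N \<rho>"
proof (induction arbitrary: \<rho> rule: alpha.induct)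
  case (Bind A A' y x M x' M' Q)
  \<comment> \<open>The side condition of the alpha rule keeps \<open>y\<close> apart from every
    free variable of \<open>K\<close> other than \<open>z\<close>, so binding \<open>y\<close> after
    the renaming gives index 0 to exactly the former occurrences of \<open>z\<close>.\<close>
  have open_body: "nameless (subst1 e K z (Var y)) (bind_env y \<rho>) = nameless K (bind_env z \<rho>)"
    if "y \<notin> set (removeAll z (fv K))" for K z
    unfolding subst1_def nameless_subst[OF assms]
  proof (rule nameless_cong)
    fix w assume "w \<in> set (fv K)"
    with that show "nameless ((Var(z := Var y)) w) (bind_env y \<rho>) = bind_env z \<rho> w"
      by (cases "w = z") (simp_all add: bind_env_def, metis)
  qed
  have "nameless M (bind_env x \<rho>) = nameless M' (bind_env x' \<rho>)"
    using open_body[OF Bind.hyps(2)] open_body[OF Bind.hyps(3)] Bind.hyps(4) by simp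
  with Bind.IH show ?case by simp
qed simp_all

primrec dfv :: "'c dterm \<Rightarrow> nat set" where
  "dfv (DConst c) = {}"
| "dfv (DVar n) = {n}"
| "dfv (DBind Q A M) = dfv A \<union> {n. Suc n \<in> dfv M}"
| "dfv (DApp M N) = dfv M \<union> dfv N"

text \<open>The counterpart of \<open>bind_env\<close> for environments whose values are variables;
  by \<open>bind_env_DVar\<close> this class is closed under passing a binder, so inductions can
  range over \<open>r\<close>.\<close>

definition bind_idx :: "'v \<Rightarrow> ('v \<Rightarrow> nat) \<Rightarrow> 'v \<Rightarrow> nat" where
  "bind_idx x r = (Suc \<circ> r)(x := 0)"

lemma bind_env_DVar: "bind_env x (\<lambda>z. DVar (r z)) = (\<lambda>z. DVar (bind_idx x r z))"
  by (rule ext) (simp add: bind_env_def bind_idx_def)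

text \<open>Used to see that terms with equal interpretations have free variables occupying the same
  indices.\<close>

lemma dfv_nameless: "dfv (nameless M (\<lambda>z. DVar (r z))) = r ` set (fv M)"
proof (induction M arbitrary: r)
  case (Bind Q x A M)
  have "{n. Suc n \<in> bind_idx x r ` set (fv M)} = r ` (set (fv M) - {x})"
    by (auto simp: bind_idx_def image_iff split: if_splits)
  with Bind show ?case by (simp add: bind_env_DVar image_Un)
qed (auto simp: image_Un)

lemma choice_cong:
  assumes "\<sigma> ` set xs = \<sigma>' ` set ys"
  shows "choice e \<sigma> xs = choice e \<sigma>' ys"
proof -
  have image: "choice e \<tau> zs = e (LEAST n. \<forall>t\<in>\<tau> ` set zs. e n \<notin> set (fv t))" for \<tau> zs
    unfolding choice_def by (simp only: ball_simps(9))
  show ?thesis unfolding image assms ..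
qed

text \<open>Syntactic equality holds because the bound variables chosen by \<open>subst\<close> depend only on
  the set of terms substituted for the free variables, not on the old bound names.\<close>

lemma nameless_eq_imp_subst_eq:
  assumes "nameless M (\<lambda>z. DVar (r z)) = nameless M' (\<lambda>z. DVar (r' z))"
    and "\<And>z z'. z \<in> set (fv M) \<Longrightarrow> z' \<in> set (fv M') \<Longrightarrow> r z = r' z' \<Longrightarrow> \<sigma> z = \<sigma>' z'"
  shows "subst e M \<sigma> = subst e M' \<sigma>'"
  using assms
\<comment> \<open>Separate assignments \<open>r\<close> and \<open>r'\<close> are carried along
  because different names may be bound on the two sides.\<close>
proof (induction M arbitrary: M' r r' \<sigma> \<sigma>')
  case (Const c)
  then show ?case by (cases M') auto
next
  case (Var x)
  then show ?case by (cases M') auto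
next
  case (App K L)
  from App.prems(1) obtain K' L' where M': "M' = App K' L'"
    by (cases M') auto
  have "subst e K \<sigma> = subst e K' \<sigma>'"
    using App.prems M' by (intro App.IH(1)[of r _ r']) auto
  moreover have "subst e L \<sigma> = subst e L' \<sigma>'"
    using App.prems M' by (intro App.IH(2)[of r _ r']) auto
  ultimately show ?case using M' by simp
next
  case (Bind Q x A K)
  from Bind.prems(1) obtain x' A' K' where M': "M' = Bind Q x' A' K'"
    and A: "nameless A (\<lambda>z. DVar (r z)) = nameless A' (\<lambda>z. DVar (r' z))"
    and K: "nameless K (\<lambda>z. DVar (bind_idx x r z)) = nameless K' (\<lambda>z. DVar (bind_idx x' r' z))"
    by (cases M') (auto simp: bind_env_DVar)
  let ?F = "set (fv K) - {x}" and ?F' = "set (fv K') - {x'}"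
  have agree: "\<sigma> z = \<sigma>' z'" if "z \<in> ?F" "z' \<in> ?F'" "r z = r' z'" for z z'
    using that M' by (intro Bind.prems(2)) auto
  have idx: "bind_idx x r ` set (fv K) = bind_idx x' r' ` set (fv K')"
    using arg_cong[OF K, of dfv] by (simp only: dfv_nameless)
  \<comment> \<open>Among the indices in the body only the bound variable has 0; discarding it and
    decrementing leaves the indices of the other free variables.\<close>
  have "r ` ?F = {n. Suc n \<in> bind_idx x r ` set (fv K)}"
    by (auto simp: bind_idx_def image_iff split: if_splits)
  also have "\<dots> = r' ` ?F'"
    unfolding idx by (auto simp: bind_idx_def image_iff split: if_splits)
  finally have rF: "r ` ?F = r' ` ?F'" .
  have "\<sigma> ` ?F = \<sigma>' ` ?F'"
  proof (intro equalityI image_subsetI)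
    fix z assume z: "z \<in> ?F"
    then have "r z \<in> r' ` ?F'" using rF by blast
    then obtain z' where "z' \<in> ?F'" "r z = r' z'" by blast
    with agree[OF z] show "\<sigma> z \<in> \<sigma>' ` ?F'" by blast
  next
    fix z' assume z': "z' \<in> ?F'"
    then have "r' z' \<in> r ` ?F" using rF by blast
    then obtain z where "z \<in> ?F" "r z = r' z'" by (metis imageE)
    with agree[OF _ z'] show "\<sigma>' z' \<in> \<sigma> ` ?F" by (metis imageI)
  qed
  then have ch: "choice e \<sigma> (removeAll x (fv K)) = choice e \<sigma>' (removeAll x' (fv K'))"
    by (intro choice_cong) simp
  have "subst e A \<sigma> = subst e A' \<sigma>'"
    using Bind.prems(2) M' by (intro Bind.IH(1)[OF A]) auto
  \<comment> \<open>Equal indices in the bodies are either both 0, where \<open>x\<close> and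
    \<open>x'\<close> are both sent to \<open>Var y\<close>, or both successors, where
    \<open>agree\<close> applies.\<close>
  moreover have "subst e K (\<sigma>(x := Var y)) = subst e K' (\<sigma>'(x' := Var y))" for y
    using agree by (intro Bind.IH(2)[OF K]) (auto simp: bind_idx_def split: if_splits)
  ultimately show ?case using ch M' by (simp add: Let_def)
qed

text \<open>Injectivity of \<open>r\<close> recovers the names of free variables. At a binder the
  domain goes by induction, while the syntactic equality of bodies that \<open>alpha.Bind\<close>
  asks for comes from \<open>nameless_eq_imp_subst_eq\<close>.\<close>

lemma nameless_eq_imp_alpha:
  fixes e :: "nat \<Rightarrow> 'v" and M :: "('c, 'v) trm"
  assumes "bij e" "inj r" "nameless M (\<lambda>z. DVar (r z)) = nameless N (\<lambda>z. DVar (r z))"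
  shows "alpha e M N"
  using assms(3)
proof (induction M arbitrary: N)
  case (Const c)
  then show ?case by (cases N) (auto intro: alpha.intros)
next
  case (Var x)
  with assms(2) show ?case by (cases N) (auto intro: alpha.intros dest: injD)
next
  case (App K L)
  then show ?case by (cases N) (auto intro: alpha.intros)
next
  case (Bind Q x A K)
  from Bind.prems obtain x' A' K' where N: "N = Bind Q x' A' K'"
    and A: "nameless A (\<lambda>z. DVar (r z)) = nameless A' (\<lambda>z. DVar (r z))"
    and K: "nameless K (\<lambda>z. DVar (bind_idx x r z)) = nameless K' (\<lambda>z. DVar (bind_idx x' r z))"
    by (cases N) (auto simp: bind_env_DVar)
  have "infinite (UNIV :: 'v set)"
    using assms(1) bij_betw_finite infinite_UNIV_nat by blast
  then obtain y where y: "y \<notin> set (fv K) \<union> set (fv K')"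
    using ex_new_if_finite[of "set (fv K) \<union> set (fv K')"] by auto
  \<comment> \<open>At equal indices the two renamings agree: 0 stands for the bound variables, both
    sent to \<open>Var y\<close>, and a successor determines a single name since \<open>r\<close> is
    injective.\<close>
  have "subst1 e K x (Var y) = subst1 e K' x' (Var y)"
    unfolding subst1_def using assms(2)
    by (intro nameless_eq_imp_subst_eq[OF K])
      (auto simp: bind_idx_def split: if_splits dest: injD)
  with y A Bind.IH(1) show ?case
    unfolding N by (intro alpha.Bind[of _ _ _ y]) auto
qed

section \<open>Simulation of beta-reduction\<close>

lemma beta_imp_dbeta:
  assumes "bij e"
  shows "beta e M N \<Longrightarrow> dbeta (nameless M \<rho>) (nameless N \<rho>)"
  by (induction arbitrary: \<rho> rule: beta.induct)
    (simp_all add: nameless_subst1[OF assms] dbeta.intros)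

text \<open>Because the environment holds only variables, an abstraction in the interpretation can
  come only from a raw \<open>Bind\<close>; hence every de Bruijn redex is the image of a raw
  redex.\<close>

lemma dbeta_imp_beta:
  assumes "bij e"
  shows "dbeta (nameless M (\<lambda>z. DVar (r z))) t \<Longrightarrow> \<exists>N. beta e M N \<and> nameless N (\<lambda>z. DVar (r z)) = t"
proof (induction M arbitrary: r t)
  case (Const c)
  then show ?case by (auto elim: dbeta_DConstE)
next
  case (Var x)
  then show ?case by (auto elim: dbeta_DVarE)
next
  case (Bind Q x A M)
  from Bind.prems show ?case
    unfolding nameless.simps bind_env_DVar
  proof (cases rule: dbeta_DBindE[consumes 1, case_names domain body])
    case (domain A')
    from Bind.IH(1)[OF domain(2)] obtain B
      where "beta e A B" "nameless B (\<lambda>z. DVar (r z)) = A'" by blast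
    with domain(1) show ?thesis
      by (intro exI[of _ "Bind Q x B M"]) (simp add: beta.Bind_domain bind_env_DVar)
  next
    case (body M')
    from Bind.IH(2)[OF body(2)] obtain K
      where "beta e M K" "nameless K (\<lambda>z. DVar (bind_idx x r z)) = M'" by blast
    with body(1) show ?thesis
      by (intro exI[of _ "Bind Q x A K"]) (simp add: beta.Bind_body bind_env_DVar)
  qed
next
  case (App M N)
  from App.prems show ?case
    unfolding nameless.simps
  proof (cases rule: dbeta_DAppE[consumes 1, case_names contract left right])
    case (contract A K)
    from contract(1) obtain x B L
      where "M = Bind Lambda x B L" "K = nameless L (bind_env x (\<lambda>z. DVar (r z)))"
      by (cases M) simp_all
    with contract(2) show ?thesis
      by (intro exI[of _ "subst1 e L x N"]) (simp add: beta.contract nameless_subst1[OF assms])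
  next
    case (left M')
    from App.IH(1)[OF left(2)] obtain K
      where "beta e M K" "nameless K (\<lambda>z. DVar (r z)) = M'" by blast
    with left(1) show ?thesis
      by (intro exI[of _ "App K N"]) (simp add: beta.App_left)
  next
    case (right N')
    from App.IH(2)[OF right(2)] obtain L
      where "beta e N L" "nameless L (\<lambda>z. DVar (r z)) = N'" by blast
    with right(1) show ?thesis
      by (intro exI[of _ "App M L"]) (simp add: beta.App_right)
  qed
qed

lemma dbeta_rtranclp_imp_beta_steps:
  assumes "bij e" "dbeta\<^sup>*\<^sup>* (nameless M (\<lambda>z. DVar (r z))) t"
  shows "\<exists>N. beta_steps e M N \<and> nameless N (\<lambda>z. DVar (r z)) = t"
  using assms(2) unfolding beta_steps_def
proof induction
  case base
  then show ?case by blast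
next
  case (step t u)
  then show ?case
    by (metis dbeta_imp_beta[OF assms(1)] rtranclp.rtrancl_into_rtrancl)
qed

lemma beta_steps_imp_dbeta_rtranclp:
  assumes "bij e" "beta_steps e M N"
  shows "dbeta\<^sup>*\<^sup>* (nameless M \<rho>) (nameless N \<rho>)"
  using assms(2) unfolding beta_steps_def
  by induction (auto intro: rtranclp.rtrancl_into_rtrancl beta_imp_dbeta[OF assms(1)])

lemma beta_conv_imp_dbeta_equivclp:
  assumes "bij e" "beta_conv e M N"
  shows "equivclp dbeta (nameless M \<rho>) (nameless N \<rho>)"
  using assms(2) unfolding beta_conv_def
proof (induction rule: equivclp_induct)
  case base
  then show ?case by simp
next
  case (step N P)
  \<comment> \<open>An alpha-step turns into an equality and a beta-step into a single
    \<open>dbeta\<close> step, in either direction.\<close>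
  then have "equivclp dbeta (nameless N \<rho>) (nameless P \<rho>)"
    by (metis alpha_imp_nameless_eq[OF assms(1)] beta_imp_dbeta[OF assms(1)]
        equivclp_refl equivclp_sym r_into_equivclp)
  with step.IH show ?case by (rule equivclp_trans)
qed

text \<open>Both reductions to \<open>t\<close> are read back as raw reductions; their end points
  are both interpreted as \<open>t\<close>, hence alpha-convertible.\<close>

lemma joinable_imp_beta_steps_alpha:
  assumes "bij e" "inj r"
    and "dbeta\<^sup>*\<^sup>* (nameless M (\<lambda>z. DVar (r z))) t" "dbeta\<^sup>*\<^sup>* (nameless N (\<lambda>z. DVar (r z))) t"
  shows "\<exists>P1 P2. beta_steps e M P1 \<and> beta_steps e N P2 \<and> alpha e P1 P2"
  using dbeta_rtranclp_imp_beta_steps[OF assms(1,3)] dbeta_rtranclp_imp_beta_steps[OF assms(1,4)]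
    nameless_eq_imp_alpha[OF assms(1,2)] by metis

theorem theorem1:
  fixes e :: "nat \<Rightarrow> 'v"
  assumes "bij e"
  shows "(\<forall>M N P :: ('c, 'v) trm. beta_steps e M N \<longrightarrow> beta_steps e M P \<longrightarrow>
            (\<exists>Q1 Q2. beta_steps e N Q1 \<and> beta_steps e P Q2 \<and> alpha e Q1 Q2))
       \<and> (\<forall>M N :: ('c, 'v) trm. beta_conv e M N \<longrightarrow>
            (\<exists>P1 P2. beta_steps e M P1 \<and> beta_steps e N P2 \<and> alpha e P1 P2))"
proof (intro conjI allI impI)
  \<comment> \<open>The position in the enumeration serves as the index of a free variable, so
    distinct variables stay distinct.\<close>
  have inj: "inj (inv e)"
    using assms bij_imp_bij_inv bij_is_inj by blast
  let ?tr = "\<lambda>M :: ('c, 'v) trm. nameless M (\<lambda>z. DVar (inv e z))"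
  {
    fix M N P :: "('c, 'v) trm"
    assume "beta_steps e M N" "beta_steps e M P"
    then have "dbeta\<^sup>*\<^sup>* (?tr M) (?tr N)" "dbeta\<^sup>*\<^sup>* (?tr M) (?tr P)"
      by (simp_all add: beta_steps_imp_dbeta_rtranclp[OF assms])
    then obtain t where "dbeta\<^sup>*\<^sup>* (?tr N) t" "dbeta\<^sup>*\<^sup>* (?tr P) t"
      using confluentpD[OF confluentp_dbeta] by blast
    then show "\<exists>Q1 Q2. beta_steps e N Q1 \<and> beta_steps e P Q2 \<and> alpha e Q1 Q2"
      by (rule joinable_imp_beta_steps_alpha[OF assms inj])
  next
    fix M N :: "('c, 'v) trm"
    assume "beta_conv e M N"
    then have "equivclp dbeta (?tr M) (?tr N)"
      by (rule beta_conv_imp_dbeta_equivclp[OF assms])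
    then obtain t where "dbeta\<^sup>*\<^sup>* (?tr M) t" "dbeta\<^sup>*\<^sup>* (?tr N) t"
      \<comment> \<open>Under confluence, convertible de Bruijn terms have a common reduct.\<close>
      unfolding semiconfluentp_equivclp[OF confluentp_imp_semiconfluentp[OF confluentp_dbeta]]
      by (auto simp: rtranclp_conversep)
    then show "\<exists>P1 P2. beta_steps e M P1 \<and> beta_steps e N P2 \<and> alpha e P1 P2"
      by (rule joinable_imp_beta_steps_alpha[OF assms inj])
  }
qed

end
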